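(* Let $c\in(0,1/2)$. Then for any $f\in\mathcal{F}_c$, $$f^{\sharp}(z_0)\le\left(\frac{\sqrt{4+|z_0|^2}-|z_0|}{2}\right)^2\frac{1}{c\,(1-|z_0|^2)^2}\qquad\text{for all } z_0\in\mathbb{D}.$$
   Context: $\mathbb{D}=\{z\in\mathbb{C}:|z|<1\}$, and $\mathcal{M}(\mathbb{D})$ is the set of all meromorphic functions in $\mathbb{D}$. For $f\in\mathcal{M}(\mathbb{D})$ the spherical derivative is $f^{\sharp}(z)=\frac{|f'(z)|}{1+|f(z)|^2}$, extended continuously to the poles of $f$ (equivalently $f^\sharp=(1/f)^\sharp$ near a pole). For $c>0$, $\mathcal{F}_c=\{f\in\mathcal{M}(\mathbb{D}): f^{\sharp}(z)\ge c\text{ for all }z\in\mathbb{D}\}$. *)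

theory Defs
  imports "HOL-Complex_Analysis.Complex_Analysis"
begin

definition spherical_deriv :: "(complex \<Rightarrow> complex) \<Rightarrow> complex \<Rightarrow> real" where
  "spherical_deriv f z =
     (if is_pole f z
      then Lim (at z) (\<lambda>w. cmod (deriv f w) / (1 + (cmod (f w))\<^sup>2))
      else cmod (deriv f z) / (1 + (cmod (f z))\<^sup>2))"

text \<open>
  The extension at a pole is well defined: the limit exists, and its value is the spherical
  derivative of \<open>1 / f\<close>, which vanishes at the pole.
\<close>

lemma spherical_deriv_at_pole:
  assumes mero: "f meromorphic_on {z}" and pole: "is_pole f z"
  shows "((\<lambda>w. cmod (deriv f w) / (1 + (cmod (f w))\<^sup>2)) \<longlongrightarrow> spherical_deriv f z) (at z)"
    and "spherical_deriv f z = cmod (deriv (\<lambda>w. if w = z then 0 else 1 / f w) z)"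
proof -
  define g where "g = (\<lambda>w. if w = z then 0 else 1 / f w)"
  have "isolated_singularity_at f z"
    using mero by (simp add: meromorphic_at_iff)
  then obtain r where r: "r > 0" "f analytic_on ball z r - {z}"
    unfolding isolated_singularity_at_def by blast
  obtain s where s: "s > 0" "\<forall>w\<in>ball z s - {z}. f w \<noteq> 0"
    using non_zero_neighbour_pole[OF pole]
    by (auto simp: eventually_at dist_commute)
  define d where "d = min r s"
  have d: "d > 0" "f holomorphic_on ball z d - {z}" "\<forall>w\<in>ball z d - {z}. f w \<noteq> 0"
    using r s by (auto simp: d_def intro: holomorphic_on_subset[OF analytic_imp_holomorphic])
  have g: "g holomorphic_on ball z d"
    using is_pole_inverse_holomorphic[of "ball z d" f z] d pole
    by (simp add: g_def divide_inverse cong: if_cong)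
  have eq: "cmod (deriv g w) / (1 + (cmod (g w))\<^sup>2) = cmod (deriv f w) / (1 + (cmod (f w))\<^sup>2)"
    if w: "w \<in> ball z d - {z}" for w
  proof -
    have fw: "f w \<noteq> 0" using d w by blast
    have "(f has_field_derivative deriv f w) (at w)"
      using d(2) w by (intro holomorphic_derivI[of f "ball z d - {z}"]) auto
    then have "((\<lambda>w. 1 / f w) has_field_derivative - deriv f w / (f w)\<^sup>2) (at w)"
      using fw by (auto intro!: derivative_eq_intros simp: power2_eq_square)
    then have "(g has_field_derivative - deriv f w / (f w)\<^sup>2) (at w)"
      by (rule has_field_derivative_transform_within_open[where S = "- {z}"])
         (use w in \<open>auto simp: g_def\<close>)
    then have "deriv g w = - deriv f w / (f w)\<^sup>2"
      by (rule DERIV_imp_deriv)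
    moreover have "g w = 1 / f w" using w by (auto simp: g_def)
    moreover have "1 + 1 / (cmod (f w))\<^sup>2 = (1 + (cmod (f w))\<^sup>2) / (cmod (f w))\<^sup>2"
      using fw by (simp add: field_simps)
    ultimately show ?thesis
      using fw by (simp add: norm_divide norm_power power_divide)
  qed
  have "isCont g z" "isCont (deriv g) z"
    using g d(1) holomorphic_deriv[OF g]
    by (auto intro!: continuous_on_interior[OF holomorphic_on_imp_continuous_on])
  then have "isCont (\<lambda>w. cmod (deriv g w) / (1 + (cmod (g w))\<^sup>2)) z"
    by (auto intro!: continuous_intros simp: add_nonneg_eq_0_iff)
  then have "((\<lambda>w. cmod (deriv g w) / (1 + (cmod (g w))\<^sup>2)) \<longlongrightarrow> cmod (deriv g z)) (at z)"
    by (simp add: isCont_def g_def)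
  moreover have "\<forall>\<^sub>F w in at z.
      cmod (deriv g w) / (1 + (cmod (g w))\<^sup>2) = cmod (deriv f w) / (1 + (cmod (f w))\<^sup>2)"
    using eq d(1) by (auto simp: eventually_at dist_commute intro!: exI[of _ d])
  ultimately have lim:
      "((\<lambda>w. cmod (deriv f w) / (1 + (cmod (f w))\<^sup>2)) \<longlongrightarrow> cmod (deriv g z)) (at z)"
    using tendsto_cong by fast
  then have val: "spherical_deriv f z = cmod (deriv g z)"
    using pole by (simp add: spherical_deriv_def tendsto_Lim)
  show "((\<lambda>w. cmod (deriv f w) / (1 + (cmod (f w))\<^sup>2)) \<longlongrightarrow> spherical_deriv f z) (at z)"
    using lim val by simp
  show "spherical_deriv f z = cmod (deriv (\<lambda>w. if w = z then 0 else 1 / f w) z)"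
    using val by (simp add: g_def)
qed

text \<open>
  A meromorphic function is represented by its \<^const>\<open>nicely_meromorphic_on\<close> representative:
  analytic wherever it has no pole, with the dummy value 0 at the poles. Plain
  \<^const>\<open>meromorphic_on\<close> would also admit functions with arbitrary values at removable
  singularities. The values outside the disc are irrelevant.
\<close>

definition F_class :: "real \<Rightarrow> (complex \<Rightarrow> complex) set" where
  "F_class c = {f. f nicely_meromorphic_on ball 0 1 \<and> (\<forall>z\<in>ball 0 1. spherical_deriv f z \<ge> c)}"

end

theory Submission
  imports Defs
begin

text \<open>
  The condition on the spherical derivative becomes a bound on holomorphic functions. Write
  \<open>f = a / b\<close> with \<open>a\<close>, \<open>b\<close> holomorphic and without common zeros. Then
  \<open>spherical_deriv f = |W| / (|a|\<^sup>2 + |b|\<^sup>2)\<close> with the Wronskian \<open>W = a' b - a b'\<close>, at the poles too.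
  A positive spherical derivative thus forces \<open>W\<close> to be zero-free. Dividing \<open>a\<close> and \<open>b\<close> by a square
  root of \<open>W\<close> gives \<open>f = u / v\<close> with
    \<open>u' v - u v' = 1\<close>  and  \<open>spherical_deriv f = 1 / (|u|\<^sup>2 + |v|\<^sup>2)\<close>
  (\<open>normalised_Wronskian_representation\<close>). The lower bound \<open>c\<close> says that \<open>(u, v)\<close> maps into the
  ball of radius \<open>1 / sqrt c\<close> in \<open>\<complex>\<^sup>2\<close>.

  At a given point \<open>z0\<close> put \<open>N = |u z0|\<^sup>2 + |v z0|\<^sup>2\<close> and \<open>g = v z0 * u - u z0 * v\<close>, the component of
  \<open>(u, v)\<close> orthogonal to its value at \<open>z0\<close>, up to the factor \<open>sqrt N\<close>. So \<open>|g| \<le> sqrt (N / c)\<close>,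
  \<open>g z0 = 0\<close>, and \<open>g' z0 = 1\<close> by the Wronskian identity. Differentiating that identity gives
  \<open>u'' v - u v'' = 0\<close>, hence also \<open>g'' z0 = 0\<close>: this is the familiar fact that \<open>u\<close> and \<open>v\<close> solve an
  equation \<open>w'' + A w = 0\<close>, whose solutions have vanishing second derivative at their zeros.

  It remains to bound the derivative of a bounded function at a zero that is also an inflection
  point (\<open>Schwarz_Pick_inflection_zero\<close>). Moving the zero \<open>a\<close> to the origin by a disc automorphism
  turns the condition \<open>g'' a = 0\<close> into a relation between the first two Taylor coefficients, of
  moduli \<open>x\<close> and \<open>|a| x\<close>. The Schwarz--Pick inequality gives \<open>|a| x \<le> 1 - x\<^sup>2\<close>, and the positive
  root of this quadratic is the factor \<open>(sqrt (4 + |a|\<^sup>2) - |a|) / 2\<close>.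

  The factorisation \<open>f = a / b\<close> is taken on discs of radius \<open>\<rho> < 1\<close>, where there are only finitely
  many zeros and poles, and \<open>\<rho>\<close> tends to 1 at the end.
\<close>

section \<open>Coefficients of bounded functions on the disc\<close>

lemma bounded_on_disc_cases:
  assumes hol: "f holomorphic_on ball 0 1" and bd: "\<And>z. z \<in> ball 0 1 \<Longrightarrow> cmod (f z) \<le> 1"
  shows "f constant_on ball 0 1 \<or> (\<forall>z\<in>ball 0 1. cmod (f z) < 1)"
proof (rule disjCI)
  assume "\<not> (\<forall>z\<in>ball 0 1. cmod (f z) < 1)"
  then obtain z where z: "z \<in> ball 0 1" "\<not> cmod (f z) < 1" by blast
  then have max: "cmod (f w) \<le> cmod (f z)" if "w \<in> ball 0 1" for w
    using bd[OF that] by linarith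
  show "f constant_on ball 0 1"
    by (rule maximum_modulus_principle[where U = "ball 0 1" and \<xi> = z]) (use hol z max in auto)
qed

lemma constant_on_ball_imp_deriv_eq_0:
  fixes f :: "complex \<Rightarrow> complex"
  assumes "f constant_on ball 0 r" "z \<in> ball 0 r"
  shows "deriv f z = 0"
proof -
  obtain y where y: "\<And>w. w \<in> ball 0 r \<Longrightarrow> f w = y"
    using assms(1) by (auto simp: constant_on_def)
  have "(f has_field_derivative 0) (at z)"
    by (rule has_field_derivative_transform_within_open[where f = "\<lambda>_. y" and S = "ball 0 r"])
       (use assms y in auto)
  then show ?thesis by (rule DERIV_imp_deriv)
qed

text \<open>
  The Schwarz lemma applied to \<open>h\<close> followed by the disc automorphism that takes \<open>h 0\<close> to 0. The
  automorphism needs \<open>|h 0| < 1\<close>, which fails only for constant \<open>h\<close>.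
\<close>

lemma Schwarz_Pick_at_0:
  assumes hol: "h holomorphic_on ball 0 1" and bd: "\<And>z. z \<in> ball 0 1 \<Longrightarrow> cmod (h z) \<le> 1"
  shows "cmod (deriv h 0) \<le> 1 - (cmod (h 0))\<^sup>2"
proof (cases "h constant_on ball 0 1")
  case True
  then have "deriv h 0 = 0" by (rule constant_on_ball_imp_deriv_eq_0) simp
  then show ?thesis using bd[of 0] by (simp add: power_le_one)
next
  case False
  then have lt: "cmod (h z) < 1" if "z \<in> ball 0 1" for z
    using bounded_on_disc_cases[OF hol bd] that by blast
  define a where "a = h 0"
  have a: "cmod a < 1" unfolding a_def by (rule lt) simp
  define m where "m = Moebius_function 0 a \<circ> h"
  have m_eq: "m z = (h z - a) / (1 - cnj a * h z)" for z
    by (simp add: m_def Moebius_function_def)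
  have m_hol: "m holomorphic_on ball 0 1"
    unfolding m_def
    by (rule holomorphic_on_compose_gen[OF hol Moebius_function_holomorphic[OF a]]) (use lt in auto)
  have m_lt: "cmod (m z) < 1" if "cmod z < 1" for z
    unfolding m_def o_def by (rule Moebius_function_norm_lt_1) (use a lt that in auto)
  have "cmod (deriv m 0) \<le> 1"
    by (rule Schwarz_Lemma(2)[OF m_hol _ m_lt, of 0]) (auto simp: m_eq a_def)
  moreover have "deriv m 0 = deriv h 0 / (1 - (cmod a)\<^sup>2)"
  proof -
    have "cmod (cnj a * a) \<noteq> 1"
      using mult_strict_mono'[OF a a] by (simp add: norm_mult)
    then have nz: "1 - cnj a * a \<noteq> 0"
      by auto
    have dh: "(h has_field_derivative deriv h 0) (at 0)"
      by (rule holomorphic_derivI[OF hol]) auto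
    have "(m has_field_derivative deriv h 0 / (1 - cnj a * a)) (at 0)"
      unfolding m_eq[abs_def]
      by (rule derivative_eq_intros dh refl | use nz in \<open>simp add: a_def[symmetric]\<close>)+
    then show ?thesis
      by (simp add: DERIV_imp_deriv complex_norm_square mult.commute del: of_real_power)
  qed
  moreover have "1 - (cmod a)\<^sup>2 > 0"
    using a by (simp add: abs_square_less_1)
  moreover have "cmod (1 - complex_of_real ((cmod a)\<^sup>2)) = \<bar>1 - (cmod a)\<^sup>2\<bar>"
    by (metis norm_of_real of_real_1 of_real_diff)
  ultimately show ?thesis
    by (simp add: norm_divide a_def)
qed

text \<open>
  \<open>G z = z * h z\<close> with \<open>|h| \<le> 1\<close> by the Schwarz lemma, so the first two coefficients of \<open>G\<close> are
  \<open>h 0\<close> and \<open>h' 0\<close>, and the previous inequality applies to \<open>h\<close>.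
\<close>

lemma Schwarz_second_coefficient:
  assumes hol: "G holomorphic_on ball 0 1" and bd: "\<And>z. z \<in> ball 0 1 \<Longrightarrow> cmod (G z) \<le> 1"
    and G0: "G 0 = 0"
  shows "cmod (deriv (deriv G) 0) / 2 \<le> 1 - (cmod (deriv G 0))\<^sup>2"
proof (cases "G constant_on ball 0 1")
  case True
  then have "deriv G constant_on ball 0 1"
    using constant_on_ball_imp_deriv_eq_0[of G 1] by (auto simp: constant_on_def)
  then have "deriv (deriv G) 0 = 0" "deriv G 0 = 0"
    using True by (simp_all add: constant_on_ball_imp_deriv_eq_0[where r = 1])
  then show ?thesis by simp
next
  case False
  then have lt: "cmod (G z) < 1" if "cmod z < 1" for z
    using bounded_on_disc_cases[OF hol bd] that by auto
  obtain h where h: "h holomorphic_on ball 0 1" "\<And>z. cmod z < 1 \<Longrightarrow> G z = z * h z" "deriv G 0 = h 0"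
    using Schwarz3[OF hol G0] by blast
  have h_le: "cmod (h z) \<le> 1" if "z \<in> ball 0 1" for z
  proof (cases "z = 0")
    case True
    have "cmod (deriv G 0) \<le> 1"
      by (rule Schwarz_Lemma(2)[where f = G and \<xi> = 0]) (use hol G0 lt in auto)
    then show ?thesis using h(3) True by simp
  next
    case z: False
    have "cmod (G z) \<le> cmod z"
      by (rule Schwarz_Lemma(1)[where f = G]) (use hol G0 lt that in auto)
    then show ?thesis using h(2)[of z] z that by (simp add: norm_mult)
  qed
  have dh: "(h has_field_derivative deriv h z) (at z)" if "z \<in> ball 0 1" for z
    by (rule holomorphic_derivI[OF h(1)]) (use that in auto)
  have dG: "deriv G z = h z + z * deriv h z" if "z \<in> ball 0 1" for z
  proof (rule DERIV_imp_deriv)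
    show "(G has_field_derivative h z + z * deriv h z) (at z)"
      by (rule has_field_derivative_transform_within_open[where f = "\<lambda>z. z * h z" and S = "ball 0 1"])
         (use that h(2) in \<open>auto intro!: derivative_eq_intros dh\<close>)
  qed
  have "(deriv h has_field_derivative deriv (deriv h) 0) (at 0)"
    by (rule holomorphic_derivI[where S = "ball 0 1"]) (auto intro: holomorphic_deriv h(1))
  then have "((\<lambda>z. h z + z * deriv h z) has_field_derivative 2 * deriv h 0) (at 0)"
    by (auto intro!: derivative_eq_intros dh)
  then have "(deriv G has_field_derivative 2 * deriv h 0) (at 0)"
    by (rule has_field_derivative_transform_within_open[where S = "ball 0 1"]) (use dG in auto)
  then have "deriv (deriv G) 0 = 2 * deriv h 0" by (rule DERIV_imp_deriv)
  then show ?thesis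
    using Schwarz_Pick_at_0[OF h(1) h_le] h(3) by (simp add: norm_mult)
qed

lemma quadratic_root_bound:
  fixes x r :: real
  assumes "r * x \<le> 1 - x\<^sup>2"
  shows "x \<le> (sqrt (4 + r\<^sup>2) - r) / 2"
proof -
  have "(2 * x + r)\<^sup>2 \<le> 4 + r\<^sup>2"
    using assms by (simp add: power2_eq_square algebra_simps)
  then have "2 * x + r \<le> sqrt (4 + r\<^sup>2)"
    by (rule real_le_rsqrt)
  then show ?thesis by simp
qed

text \<open>
  The automorphism \<open>\<psi>\<close> with \<open>\<psi> 0 = a\<close> is not affine: \<open>\<psi>'' 0 = - 2 * cnj a * \<psi>' 0\<close>. So although
  \<open>g'' a = 0\<close>, the second coefficient of \<open>g \<circ> \<psi>\<close> is \<open>- cnj a\<close> times the first, and the inequality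
  between the two coefficients improves for
  \<open>a \<noteq> 0\<close> on the bound \<open>M / (1 - |a|\<^sup>2)\<close> of Schwarz--Pick.
\<close>

lemma Schwarz_Pick_inflection_zero:
  assumes hol: "g holomorphic_on ball 0 1" and bd: "\<And>z. z \<in> ball 0 1 \<Longrightarrow> cmod (g z) \<le> M"
    and M: "M > 0" and a: "cmod a < 1"
    and g0: "g a = 0" and g2: "deriv (deriv g) a = 0"
  shows "cmod (deriv g a) * (1 - (cmod a)\<^sup>2) \<le> M * ((sqrt (4 + (cmod a)\<^sup>2) - cmod a) / 2)"
proof -
  define \<psi> where "\<psi> = Moebius_function 0 (- a)"
  (* p is the derivative of \<psi> at 0. *)
  define p where "p = complex_of_real (1 - (cmod a)\<^sup>2)"
  have p: "p = 1 - cnj a * a"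
    by (simp add: p_def complex_norm_square mult.commute del: of_real_power)
  have \<psi>_eq: "\<psi> z = (z + a) / (1 + cnj a * z)" for z
    by (simp add: \<psi>_def Moebius_function_def)
  have \<psi>_hol: "\<psi> holomorphic_on ball 0 1"
    unfolding \<psi>_def by (rule Moebius_function_holomorphic) (use a in simp)
  have \<psi>_in: "\<psi> z \<in> ball 0 1" if "z \<in> ball 0 1" for z
    unfolding \<psi>_def using Moebius_function_norm_lt_1[of "-a" z 0] a that by simp
  have nz: "1 + cnj a * z \<noteq> 0" if "z \<in> ball 0 1" for z
  proof
    assume "1 + cnj a * z = 0"
    then have "cmod (cnj a * z) = 1" by (metis add_eq_0_iff norm_minus_cancel norm_one)
    moreover have "cmod a * cmod z < 1"
      using a that by (metis mem_ball_0 mult_strict_mono' norm_ge_zero mult_1)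
    ultimately show False by (simp add: norm_mult)
  qed
  have d\<psi>: "(\<psi> has_field_derivative p / (1 + cnj a * z)\<^sup>2) (at z)" if "z \<in> ball 0 1" for z
    unfolding \<psi>_eq[abs_def]
    by (rule derivative_eq_intros refl nz[OF that])+
       (use nz[OF that] in \<open>simp add: p divide_simps power2_eq_square\<close>, simp add: algebra_simps)
  define G where "G = (\<lambda>z. g (\<psi> z) / M)"
  have G_hol: "G holomorphic_on ball 0 1"
    unfolding G_def using M \<psi>_in
    by (intro holomorphic_intros holomorphic_on_compose_gen[OF \<psi>_hol hol, unfolded o_def]) auto
  have G_le: "cmod (G z) \<le> 1" if "z \<in> ball 0 1" for z
    using bd[OF \<psi>_in[OF that]] M by (simp add: G_def norm_divide)
  have dg: "(g has_field_derivative deriv g z) (at z)"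
      "(deriv g has_field_derivative deriv (deriv g) z) (at z)" if "z \<in> ball 0 1" for z
    using that hol by (auto intro!: holomorphic_derivI[where S = "ball 0 1"] holomorphic_deriv)
  have dG: "(G has_field_derivative deriv g (\<psi> z) * (p / (1 + cnj a * z)\<^sup>2) / M) (at z)"
    if "z \<in> ball 0 1" for z
    unfolding G_def by (intro DERIV_cdivide DERIV_chain2[OF dg(1)] \<psi>_in d\<psi> that)
  have G1: "deriv G 0 = deriv g a * p / M"
    using DERIV_imp_deriv[OF dG[of 0]] by (simp add: \<psi>_eq)
  have \<psi>0: "\<psi> 0 = a" by (simp add: \<psi>_eq)
  have G0: "G 0 = 0" by (simp add: G_def \<psi>0 g0)
  have d2: "((\<lambda>z. deriv g (\<psi> z)) has_field_derivative 0) (at 0)"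
    using DERIV_chain2[of "deriv g" "deriv (deriv g) (\<psi> 0)" \<psi> 0 "p / (1 + cnj a * 0)\<^sup>2" UNIV]
      dg(2)[of a] d\<psi>[of 0] a by (simp add: g2 \<psi>0)
  have "((\<lambda>z. deriv g (\<psi> z) * (p / (1 + cnj a * z)\<^sup>2) / M) has_field_derivative
           - 2 * cnj a * deriv G 0) (at 0)"
    by (rule derivative_eq_intros d2 refl | simp)+ (use M in \<open>auto simp: \<psi>0 G1 field_simps\<close>)
  then have "(deriv G has_field_derivative - 2 * cnj a * deriv G 0) (at 0)"
    by (rule has_field_derivative_transform_within_open[where S = "ball 0 1"])
       (use DERIV_imp_deriv[OF dG] in auto)
  then have G2: "deriv (deriv G) 0 = - 2 * cnj a * deriv G 0"
    by (rule DERIV_imp_deriv)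
  have "cmod a * cmod (deriv G 0) \<le> 1 - (cmod (deriv G 0))\<^sup>2"
    using Schwarz_second_coefficient[OF G_hol G_le G0] by (simp add: G2 norm_mult)
  then have "cmod (deriv G 0) \<le> (sqrt (4 + (cmod a)\<^sup>2) - cmod a) / 2"
    by (rule quadratic_root_bound)
  moreover have "cmod (deriv G 0) = cmod (deriv g a) * (1 - (cmod a)\<^sup>2) / M"
  proof -
    have "(cmod a)\<^sup>2 < 1" using a by (simp add: abs_square_less_1)
    then have "cmod p = 1 - (cmod a)\<^sup>2" unfolding p_def norm_of_real by simp
    then show ?thesis using M by (simp add: G1 norm_mult norm_divide)
  qed
  ultimately show ?thesis using M by (simp add: divide_le_eq mult.commute)
qed

lemma Schwarz_Pick_inflection_zero_ball:
  assumes \<rho>: "\<rho> > 0" and hol: "g holomorphic_on ball 0 \<rho>"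
    and bd: "\<And>z. z \<in> ball 0 \<rho> \<Longrightarrow> cmod (g z) \<le> M"
    and M: "M > 0" and a: "cmod a < \<rho>"
    and g0: "g a = 0" and g2: "deriv (deriv g) a = 0"
  shows "cmod (deriv g a) * (\<rho> * (1 - (cmod a / \<rho>)\<^sup>2))
           \<le> M * ((sqrt (4 + (cmod a / \<rho>)\<^sup>2) - cmod a / \<rho>) / 2)"
proof -
  define G where "G = (\<lambda>z. g (of_real \<rho> * z))"
  have in_ball: "of_real \<rho> * z \<in> ball 0 \<rho>" if "z \<in> ball 0 1" for z :: complex
    using that \<rho> by (simp add: norm_mult)
  have dg: "(g has_field_derivative deriv g z) (at z)"
      "(deriv g has_field_derivative deriv (deriv g) z) (at z)" if "z \<in> ball 0 \<rho>" for z
    using that hol by (auto intro!: holomorphic_derivI[where S = "ball 0 \<rho>"] holomorphic_deriv)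
  have G_hol: "G holomorphic_on ball 0 1"
    unfolding G_def using in_ball
    by (intro holomorphic_on_compose_gen[OF _ hol, unfolded o_def] holomorphic_intros) auto
  have lin: "((\<lambda>z. of_real \<rho> * z) has_field_derivative of_real \<rho>) (at z)" for z :: complex
    by (auto intro!: derivative_eq_intros)
  have dG: "deriv G z = of_real \<rho> * deriv g (of_real \<rho> * z)" if "z \<in> ball 0 1" for z
    unfolding G_def using DERIV_chain2[OF dg(1)[OF in_ball[OF that]] lin]
    by (simp add: DERIV_imp_deriv mult.commute)
  define b where "b = a / of_real \<rho>"
  have \<rho>b: "of_real \<rho> * b = a" and b: "b \<in> ball 0 1" and nb: "cmod b = cmod a / \<rho>"
    using \<rho> a by (auto simp: b_def norm_divide)
  have "((\<lambda>z. of_real \<rho> * deriv g (of_real \<rho> * z)) has_field_derivative 0) (at b)"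
    using DERIV_chain2[OF dg(2)[OF in_ball[OF b]] lin, THEN DERIV_cmult, of "of_real \<rho>"]
    by (simp add: \<rho>b g2)
  then have "(deriv G has_field_derivative 0) (at b)"
    by (rule has_field_derivative_transform_within_open[where S = "ball 0 1"])
       (use dG b in auto)
  then have G2: "deriv (deriv G) b = 0" by (rule DERIV_imp_deriv)
  have "cmod (deriv G b) * (1 - (cmod b)\<^sup>2) \<le> M * ((sqrt (4 + (cmod b)\<^sup>2) - cmod b) / 2)"
    by (rule Schwarz_Pick_inflection_zero[OF G_hol _ M])
       (use b bd in_ball g0 G2 \<rho>b in \<open>auto simp: G_def\<close>)
  then show ?thesis
    using \<rho> b by (simp add: dG \<rho>b nb norm_mult mult.assoc mult.left_commute)
qed

section \<open>The Wronskian representation\<close>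

text \<open>
  A Weierstrass factorisation by entire functions needs zeros and poles that do not accumulate at
  the boundary. Inside the unit disc they accumulate nowhere, so every disc of radius \<open>\<rho> < 1\<close>
  qualifies.
\<close>

lemma nicely_meromorphic_quotient_on_smaller_ball:
  assumes mero: "f nicely_meromorphic_on ball 0 1" and \<rho>: "\<rho> < 1"
    and nonzero: "\<exists>z\<in>ball 0 1. f z \<noteq> 0"
  obtains a b where "a holomorphic_on ball 0 \<rho>" "b holomorphic_on ball 0 \<rho>"
    "\<And>z. z \<in> ball 0 \<rho> \<Longrightarrow> a z \<noteq> 0 \<or> b z \<noteq> 0"
    "\<And>z. z \<in> ball 0 \<rho> \<Longrightarrow> b z = 0 \<longleftrightarrow> is_pole f z"
    "\<And>z. z \<in> ball 0 \<rho> \<Longrightarrow> f z = a z / b z"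
proof -
  have sub: "ball 0 \<rho> \<subseteq> ball (0 :: complex) 1" using \<rho> by auto
  have "\<forall>\<^sub>\<approx>x\<in>ball 0 1. f x \<noteq> 0"
    using nicely_meromorphic_imp_constant_or_avoid[OF mero open_ball connected_ball, of 0] nonzero
    by auto
  then have sparse: "{x. f x = 0} sparse_in ball 0 1"
    by (simp add: eventually_cosparse)
  have pole0: "f z = 0" if "is_pole f z" "z \<in> ball 0 1" for z
    using is_pole_zero_at_nicely_mero[OF mero] that by blast
  (* Poles need no separate treatment: the normalised f vanishes at them. *)
  have lim: "\<not> z islimpt {w \<in> ball 0 \<rho>. f w = 0 \<or> is_pole f w}" if "z \<in> frontier (ball 0 \<rho>)" for z
  proof -
    have "closure (ball 0 \<rho>) \<subseteq> (cball 0 \<rho> :: complex set)"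
      by (intro closure_minimal ball_subset_cball closed_cball)
    then have "z \<in> cball 0 \<rho>" using that by (auto simp: frontier_def)
    then have "z \<in> ball 0 1" using \<rho> by auto
    then have "\<not> z islimpt {x. f x = 0}"
      using sparse by (auto simp: sparse_in_open)
    then show ?thesis
      by (rule contrapos_nn) (erule islimpt_subset, use pole0 sub in auto)
  qed
  obtain h f1 f2 where h: "h holomorphic_on ball 0 \<rho>" "f1 holomorphic_on UNIV" "f2 holomorphic_on UNIV"
    "\<forall>z\<in>ball 0 \<rho>. f1 z = 0 \<longleftrightarrow> \<not>is_pole f z \<and> f z = 0"
    "\<forall>z\<in>ball 0 \<rho>. f2 z = 0 \<longleftrightarrow> is_pole f z"
    "\<forall>z\<in>ball 0 \<rho>. h z \<noteq> 0"
    "\<forall>z\<in>ball 0 \<rho>. f z = h z * f1 z / f2 z"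
    by (rule weierstrass_factorization_meromorphic[OF nicely_meromorphic_on_subset[OF mero sub]
          open_ball connected_ball], rule lim, assumption)
       (rule that)
  show ?thesis
  proof (rule that[of "\<lambda>z. h z * f1 z" f2])
    show "(\<lambda>z. h z * f1 z) holomorphic_on ball 0 \<rho>" "f2 holomorphic_on ball 0 \<rho>"
      using h(1-3) by (auto intro!: holomorphic_intros intro: holomorphic_on_subset)
  qed (use h(4-7) in auto)
qed

text \<open>
  Away from the poles this is the quotient rule. The right-hand side is continuous also at the
  poles, since \<open>a\<close> and \<open>b\<close> have no common zero, and it therefore equals the limit there.
\<close>

lemma spherical_deriv_quotient:
  assumes mero: "f meromorphic_on {z}" and S: "open S" "z \<in> S"
    and a: "a holomorphic_on S" and b: "b holomorphic_on S"
    and nz: "\<And>w. w \<in> S \<Longrightarrow> a w \<noteq> 0 \<or> b w \<noteq> 0"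
    and pole: "\<And>w. w \<in> S \<Longrightarrow> b w = 0 \<longleftrightarrow> is_pole f w"
    and eq: "\<And>w. w \<in> S \<Longrightarrow> f w = a w / b w"
  shows "spherical_deriv f z =
           cmod (deriv a z * b z - a z * deriv b z) / ((cmod (a z))\<^sup>2 + (cmod (b z))\<^sup>2)"
proof -
  define R where
    "R w = cmod (deriv a w * b w - a w * deriv b w) / ((cmod (a w))\<^sup>2 + (cmod (b w))\<^sup>2)" for w
  have off: "cmod (deriv f w) / (1 + (cmod (f w))\<^sup>2) = R w" if w: "w \<in> S" "b w \<noteq> 0" for w
  proof -
    have b_open: "open {w \<in> S. b w \<noteq> 0}"
      using continuous_open_preimage[OF holomorphic_on_imp_continuous_on[OF b] S(1), of "- {0}"]
      by (simp add: Int_def vimage_def open_Compl)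
    have "((\<lambda>w. a w / b w) has_field_derivative (deriv a w * b w - a w * deriv b w) / (b w * b w)) (at w)"
      by (rule DERIV_divide) (use w S a b in \<open>auto intro: holomorphic_derivI\<close>)
    then have "(f has_field_derivative (deriv a w * b w - a w * deriv b w) / (b w * b w)) (at w)"
      by (rule has_field_derivative_transform_within_open[OF _ b_open]) (use w eq in auto)
    then have "deriv f w = (deriv a w * b w - a w * deriv b w) / (b w * b w)"
      by (rule DERIV_imp_deriv)
    moreover have "1 + (cmod (f w))\<^sup>2 = ((cmod (a w))\<^sup>2 + (cmod (b w))\<^sup>2) / (cmod (b w))\<^sup>2"
      using w by (simp add: eq norm_divide power_divide field_simps)
    ultimately show ?thesis
      using w by (simp add: R_def norm_divide norm_mult power2_eq_square)
  qed
  show ?thesis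
  proof (cases "is_pole f z")
    case False
    then show ?thesis
      using off[of z] pole[of z] S by (simp add: spherical_deriv_def R_def)
  next
    case True
    have cont: "isCont a z" "isCont b z" "isCont (deriv a) z" "isCont (deriv b) z"
      using S a b holomorphic_deriv[OF a] holomorphic_deriv[OF b]
      by (auto simp: continuous_on_eq_continuous_at dest!: holomorphic_on_imp_continuous_on)
    have "(cmod (a z))\<^sup>2 + (cmod (b z))\<^sup>2 \<noteq> 0"
      using nz[OF S(2)] by (simp add: sum_power2_eq_zero_iff)
    then have "isCont R z"
      unfolding R_def[abs_def] using cont by (intro continuous_intros) auto
    then have "(R \<longlongrightarrow> R z) (at z)" by (simp add: isCont_def)
    moreover have "\<forall>\<^sub>F w in at z. cmod (deriv f w) / (1 + (cmod (f w))\<^sup>2) = R w"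
    proof -
      have "\<forall>\<^sub>F w in at z. f w \<noteq> 0" using non_zero_neighbour_pole[OF True] .
      moreover have "\<forall>\<^sub>F w in at z. w \<in> S" using S by (rule eventually_at_in_open')
      ultimately show ?thesis
        by eventually_elim (use off eq in auto)
    qed
    ultimately have "((\<lambda>w. cmod (deriv f w) / (1 + (cmod (f w))\<^sup>2)) \<longlongrightarrow> R z) (at z)"
      by (simp add: tendsto_cong)
    then show ?thesis
      using tendsto_unique[OF _ spherical_deriv_at_pole(1)[OF mero True]] by (simp add: R_def)
  qed
qed

text \<open>
  Dividing both functions by \<open>s\<close> divides their Wronskian by \<open>s\<^sup>2\<close>, because the terms with the
  derivative of \<open>s\<close> cancel. So \<open>s\<close> is a square root of the Wronskian, which exists on a disc as
  the Wronskian has no zeros.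
\<close>

lemma normalised_Wronskian_representation:
  assumes mero: "f nicely_meromorphic_on ball 0 1" and \<rho>: "\<rho> < 1"
    and pos: "\<And>z. z \<in> ball 0 1 \<Longrightarrow> spherical_deriv f z > 0"
  obtains u v where "u holomorphic_on ball 0 \<rho>" "v holomorphic_on ball 0 \<rho>"
    "\<And>z. z \<in> ball 0 \<rho> \<Longrightarrow> deriv u z * v z - u z * deriv v z = 1"
    "\<And>z. z \<in> ball 0 \<rho> \<Longrightarrow> spherical_deriv f z = 1 / ((cmod (u z))\<^sup>2 + (cmod (v z))\<^sup>2)"
proof -
  have nonzero: "\<exists>z\<in>ball 0 1. f z \<noteq> 0"
  proof (rule ccontr)
    assume "\<not> (\<exists>z\<in>ball 0 1. f z \<noteq> 0)"
    then have zero: "f z = 0" if "z \<in> ball 0 1" for z using that by blast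
    have "f analytic_on {0}"
      by (rule analytic_on_subset[of _ "ball 0 1"])
         (auto simp: analytic_on_open zero intro: holomorphic_transform[of "\<lambda>_. 0"])
    then have "\<not> is_pole f 0"
      using analytic_at_imp_no_pole by blast
    moreover have "deriv f 0 = 0"
      by (rule constant_on_ball_imp_deriv_eq_0[where r = 1]) (use zero in \<open>auto simp: constant_on_def\<close>)
    ultimately show False using pos[of 0] by (simp add: spherical_deriv_def)
  qed
  obtain a b where a: "a holomorphic_on ball 0 \<rho>" and b: "b holomorphic_on ball 0 \<rho>"
    and ab: "\<And>z. z \<in> ball 0 \<rho> \<Longrightarrow> a z \<noteq> 0 \<or> b z \<noteq> 0"
      "\<And>z. z \<in> ball 0 \<rho> \<Longrightarrow> b z = 0 \<longleftrightarrow> is_pole f z"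
      "\<And>z. z \<in> ball 0 \<rho> \<Longrightarrow> f z = a z / b z"
    using nicely_meromorphic_quotient_on_smaller_ball[OF mero \<rho> nonzero] by blast
  define W where "W z = deriv a z * b z - a z * deriv b z" for z
  have sph: "spherical_deriv f z = cmod (W z) / ((cmod (a z))\<^sup>2 + (cmod (b z))\<^sup>2)"
    if z: "z \<in> ball 0 \<rho>" for z
  proof -
    have "f meromorphic_on {z}"
      using mero z \<rho> by (auto simp: nicely_meromorphic_on_def intro: meromorphic_on_subset)
    then show ?thesis
      unfolding W_def by (rule spherical_deriv_quotient[OF _ open_ball z a b ab])
  qed
  have W_nz: "W z \<noteq> 0" if "z \<in> ball 0 \<rho>" for z
    using sph[OF that] pos[of z] that \<rho> by auto
  have W_hol: "W holomorphic_on ball 0 \<rho>"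
    unfolding W_def[abs_def] by (intro holomorphic_intros holomorphic_deriv a b open_ball)
  obtain s where s: "s holomorphic_on ball 0 \<rho>" "\<And>z. z \<in> ball 0 \<rho> \<Longrightarrow> W z = (s z)\<^sup>2"
    using contractible_imp_holomorphic_sqrt[OF W_hol convex_imp_contractible[OF convex_ball] W_nz]
    by blast
  have s_nz: "s z \<noteq> 0" if "z \<in> ball 0 \<rho>" for z
    using W_nz[OF that] s(2)[OF that] by auto
  show ?thesis
  proof (rule that[of "\<lambda>z. a z / s z" "\<lambda>z. b z / s z"])
    show "(\<lambda>z. a z / s z) holomorphic_on ball 0 \<rho>" "(\<lambda>z. b z / s z) holomorphic_on ball 0 \<rho>"
      using a b s s_nz by (auto intro!: holomorphic_intros)
  next
    fix z :: complex assume z: "z \<in> ball 0 \<rho>"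
    note nz = s_nz[OF z]
    have d: "(k has_field_derivative deriv k z) (at z)" if "k holomorphic_on ball 0 \<rho>" for k
      using holomorphic_derivI[OF that open_ball z] .
    have da: "deriv (\<lambda>z. k z / s z) z = (deriv k z * s z - k z * deriv s z) / (s z * s z)"
      if "k holomorphic_on ball 0 \<rho>" for k
      by (rule DERIV_imp_deriv[OF DERIV_divide[OF d[OF that] d[OF s(1)] nz]])
    have "deriv (\<lambda>z. a z / s z) z * (b z / s z) - a z / s z * deriv (\<lambda>z. b z / s z) z
            = W z / (s z)\<^sup>2"
      using nz unfolding da[OF a] da[OF b] W_def
      by (simp add: divide_simps power2_eq_square) (simp add: algebra_simps)
    then show "deriv (\<lambda>z. a z / s z) z * (b z / s z) - a z / s z * deriv (\<lambda>z. b z / s z) z = 1"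
      using s(2)[OF z] nz by simp
    show "spherical_deriv f z = 1 / ((cmod (a z / s z))\<^sup>2 + (cmod (b z / s z))\<^sup>2)"
      using nz unfolding sph[OF z] s(2)[OF z]
      by (simp add: norm_divide norm_power power_divide add_divide_distrib[symmetric])
  qed
qed

lemma cross_term_Cauchy_Schwarz:
  "(cmod (q * x - p * y))\<^sup>2 \<le> ((cmod p)\<^sup>2 + (cmod q)\<^sup>2) * ((cmod x)\<^sup>2 + (cmod y)\<^sup>2)"
proof -
  have "cmod (q * x - p * y) \<le> cmod q * cmod x + cmod p * cmod y"
    by (metis norm_mult norm_triangle_ineq4)
  then have "(cmod (q * x - p * y))\<^sup>2 \<le> (cmod q * cmod x + cmod p * cmod y)\<^sup>2"
    by (rule power_mono) simp
  also have "\<dots> \<le> ((cmod p)\<^sup>2 + (cmod q)\<^sup>2) * ((cmod x)\<^sup>2 + (cmod y)\<^sup>2)"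
    using zero_le_power2[of "cmod q * cmod y - cmod p * cmod x"]
    by (simp add: power2_eq_square algebra_simps)
  finally show ?thesis .
qed

section \<open>The growth estimate\<close>

text \<open>
  The estimate of \<open>Schwarz_Pick_inflection_zero_ball\<close> for \<open>g = v z0 * u - u z0 * v\<close>. Here
  \<open>g' z0 = 1\<close>, and the size of the spherical derivative at \<open>z0\<close> enters through the bound
  \<open>sqrt (N / c)\<close> on \<open>g\<close>, where \<open>N = 1 / spherical_deriv f z0\<close>.
\<close>

lemma spherical_deriv_le_on_smaller_ball:
  assumes f: "f \<in> F_class c" and c: "c > 0" and \<rho>: "\<rho> < 1" and z0: "cmod z0 < \<rho>"
  shows "spherical_deriv f z0 * (\<rho> * (1 - (cmod z0 / \<rho>)\<^sup>2))\<^sup>2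
           \<le> ((sqrt (4 + (cmod z0 / \<rho>)\<^sup>2) - cmod z0 / \<rho>) / 2)\<^sup>2 / c"
proof -
  have mero: "f nicely_meromorphic_on ball 0 1"
    and low: "\<And>z. z \<in> ball 0 1 \<Longrightarrow> spherical_deriv f z \<ge> c"
    using f by (auto simp: F_class_def)
  have \<rho>0: "\<rho> > 0" using z0 norm_ge_zero[of z0] by linarith
  obtain u v where u: "u holomorphic_on ball 0 \<rho>" and v: "v holomorphic_on ball 0 \<rho>"
    and wr: "\<And>z. z \<in> ball 0 \<rho> \<Longrightarrow> deriv u z * v z - u z * deriv v z = 1"
    and sph: "\<And>z. z \<in> ball 0 \<rho> \<Longrightarrow> spherical_deriv f z = 1 / ((cmod (u z))\<^sup>2 + (cmod (v z))\<^sup>2)"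
    using normalised_Wronskian_representation[OF mero \<rho> less_le_trans[OF c low]] by blast
  have z0_in: "z0 \<in> ball 0 \<rho>" using z0 by simp
  have d: "(k has_field_derivative deriv k z) (at z)"
      "(deriv k has_field_derivative deriv (deriv k) z) (at z)"
    if "k holomorphic_on ball 0 \<rho>" "z \<in> ball 0 \<rho>" for k z
    using that by (auto intro!: holomorphic_derivI[where S = "ball 0 \<rho>"] holomorphic_deriv)
  define p q where "p = u z0" and "q = v z0"
  define N where "N = (cmod p)\<^sup>2 + (cmod q)\<^sup>2"
  define g where "g z = q * u z - p * v z" for z
  have S: "spherical_deriv f z0 = 1 / N"
    using sph[OF z0_in] by (simp add: N_def p_def q_def)
  have N: "N > 0"
  proof -
    have "c \<le> 1 / N" using low[of z0] z0 \<rho> S by simp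
    then show ?thesis using c zero_less_divide_1_iff[of N] by linarith
  qed
  have g_hol: "g holomorphic_on ball 0 \<rho>"
    unfolding g_def[abs_def] by (intro holomorphic_intros u v)
  have dg: "deriv g z = q * deriv u z - p * deriv v z" if "z \<in> ball 0 \<rho>" for z
    unfolding g_def[abs_def]
    by (intro DERIV_imp_deriv derivative_intros DERIV_cmult d u v that)
  have g1: "deriv g z0 = 1"
    using wr[OF z0_in] by (simp add: dg[OF z0_in] p_def q_def mult.commute)
  have g2: "deriv (deriv g) z0 = 0"
  proof -
    have "((\<lambda>z. q * deriv u z - p * deriv v z) has_field_derivative
             q * deriv (deriv u) z0 - p * deriv (deriv v) z0) (at z0)"
      by (intro derivative_intros DERIV_cmult d u v z0_in)
    then have "(deriv g has_field_derivative
             q * deriv (deriv u) z0 - p * deriv (deriv v) z0) (at z0)"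
      by (rule has_field_derivative_transform_within_open[where S = "ball 0 \<rho>"])
         (use dg z0 in auto)
    then have "deriv (deriv g) z0 = q * deriv (deriv u) z0 - p * deriv (deriv v) z0"
      by (rule DERIV_imp_deriv)
    (* The derivative of the Wronskian, which is constant. *)
    moreover have "((\<lambda>z. deriv u z * v z - u z * deriv v z) has_field_derivative
        deriv (deriv u) z0 * q - p * deriv (deriv v) z0) (at z0)"
      unfolding p_def q_def
      by (rule derivative_eq_intros d u v z0_in refl)+ (simp add: algebra_simps)
    then have "((\<lambda>_. 1) has_field_derivative
        deriv (deriv u) z0 * q - p * deriv (deriv v) z0) (at z0)"
      by (rule has_field_derivative_transform_within_open[where S = "ball 0 \<rho>"])
         (use wr z0 in auto)
    then have "deriv (deriv u) z0 * q - p * deriv (deriv v) z0 = 0"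
      using DERIV_unique[OF _ DERIV_const] by blast
    ultimately show ?thesis by (simp add: mult.commute)
  qed
  have g_le: "cmod (g z) \<le> sqrt (N / c)" if z: "z \<in> ball 0 \<rho>" for z
  proof (rule real_le_rsqrt)
    define T where "T = (cmod (u z))\<^sup>2 + (cmod (v z))\<^sup>2"
    have "c \<le> 1 / T"
      using low[of z] sph[OF z] z \<rho> by (simp add: T_def)
    moreover from this have "T > 0"
      using c zero_less_divide_1_iff[of T] by linarith
    ultimately have "N * T \<le> N / c"
      using N c by (simp add: field_simps)
    then show "(cmod (g z))\<^sup>2 \<le> N / c"
      using cross_term_Cauchy_Schwarz[of q "u z" p "v z"] by (simp add: g_def N_def T_def)
  qed
  let ?t = "\<rho> * (1 - (cmod z0 / \<rho>)\<^sup>2)"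
  let ?k = "(sqrt (4 + (cmod z0 / \<rho>)\<^sup>2) - cmod z0 / \<rho>) / 2"
  have "cmod (deriv g z0) * ?t \<le> sqrt (N / c) * ?k"
    by (rule Schwarz_Pick_inflection_zero_ball[OF \<rho>0 g_hol g_le _ z0 _ g2])
       (use N c in \<open>auto simp: g_def p_def q_def\<close>)
  then have "?t \<le> sqrt (N / c) * ?k"
    by (simp add: g1)
  moreover have "?t \<ge> 0"
    using \<rho>0 z0 by (simp add: abs_square_le_1)
  ultimately have "?t\<^sup>2 \<le> (sqrt (N / c) * ?k)\<^sup>2"
    by (intro power_mono)
  also have "\<dots> = N / c * ?k\<^sup>2"
    using N c by (simp only: power_mult_distrib) simp
  finally show ?thesis
    using N unfolding S by (simp add: divide_le_eq mult.commute)
qed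

theorem theorem1p3:
  fixes c :: real and f :: "complex \<Rightarrow> complex"
  assumes "c \<in> {0<..<1/2}"
    and "f \<in> F_class c"
  shows "\<forall>z0\<in>ball 0 1.
    spherical_deriv f z0 \<le>
      ((sqrt (4 + (cmod z0)\<^sup>2) - cmod z0) / 2)\<^sup>2 * (1 / (c * (1 - (cmod z0)\<^sup>2)\<^sup>2))"
proof
  fix z0 :: complex assume "z0 \<in> ball 0 1"
  then have r: "cmod z0 < 1" by simp
  have c: "c > 0" using assms(1) by simp
  let ?S = "spherical_deriv f z0"
  have lhs: "((\<lambda>\<rho>. ?S * (\<rho> * (1 - (cmod z0 / \<rho>)\<^sup>2))\<^sup>2) \<longlongrightarrow>
      ?S * (1 * (1 - (cmod z0 / 1)\<^sup>2))\<^sup>2) (at_left 1)"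
    by (intro tendsto_intros) auto
  have rhs: "((\<lambda>\<rho>. ((sqrt (4 + (cmod z0 / \<rho>)\<^sup>2) - cmod z0 / \<rho>) / 2)\<^sup>2 / c) \<longlongrightarrow>
      ((sqrt (4 + (cmod z0 / 1)\<^sup>2) - cmod z0 / 1) / 2)\<^sup>2 / c) (at_left 1)"
    using c by (intro tendsto_intros) auto
  have "\<forall>\<^sub>F \<rho> in at_left 1. \<rho> \<in> {cmod z0<..<1}"
    using r by (rule eventually_at_left_real)
  then have "\<forall>\<^sub>F \<rho> in at_left 1. ?S * (\<rho> * (1 - (cmod z0 / \<rho>)\<^sup>2))\<^sup>2
      \<le> ((sqrt (4 + (cmod z0 / \<rho>)\<^sup>2) - cmod z0 / \<rho>) / 2)\<^sup>2 / c"
    by eventually_elim (use spherical_deriv_le_on_smaller_ball[OF assms(2) c] in auto)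
  then have le: "?S * (1 - (cmod z0)\<^sup>2)\<^sup>2 \<le> ((sqrt (4 + (cmod z0)\<^sup>2) - cmod z0) / 2)\<^sup>2 / c"
    using tendsto_le[OF _ rhs lhs] by simp
  have "1 - (cmod z0)\<^sup>2 > 0"
    using r by (simp add: abs_square_less_1)
  then have "?S \<le> ((sqrt (4 + (cmod z0)\<^sup>2) - cmod z0) / 2)\<^sup>2 / c / (1 - (cmod z0)\<^sup>2)\<^sup>2"
    using le by (simp only: pos_le_divide_eq zero_less_power)
  then show "?S \<le> ((sqrt (4 + (cmod z0)\<^sup>2) - cmod z0) / 2)\<^sup>2 * (1 / (c * (1 - (cmod z0)\<^sup>2)\<^sup>2))"
    by simp
qed

end
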